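(* For every $(\varepsilon,\delta)\in\mathbb{R}^2$, the transformation $\sigma_{(\varepsilon,\delta)}$ of the set of overmarked boxes commutes with the involution $j$, and therefore induces a transformation of the set of marked boxes.
   Context: Let $V$ be a 3-dimensional real vector space. An overmarked box is $\Theta=((p,q,r,s;t,b),(P,Q,R,S;T,B))$ with $p,\dots,b\in\mathbf{P}(V)$ and lines $P,\dots,B$ of $\mathbf{P}(V)$ such that $P=ts$, $Q=tr$, $R=bq$, $S=bp$, $T=pq$, $B=rs$ (here $xy$ is the line through points $x,y$) and $T\cap B\notin\{p,q,r,s,t,b\}$. A $\Theta$-basis is a basis of $V$, unique up to scaling, in which $p=[-1:1:0]$, $q=[1:1:0]$, $r=[1:0:1]$, $s=[-1:0:1]$. The involution $j$ maps $\Theta$ to $((q,p,s,r;t,b),(Q,P,S,R;T,B))$; marked boxes are $j$-orbits. For $(\varepsilon,\delta)\in\mathbb{R}^2$ let $$\Sigma_{(\varepsilon,\delta)}=\begin{pmatrix}1&0&0\\0&e^{-\delta}\cosh\varepsilon&-\sinh\varepsilon\\0&-\sinh\varepsilon&e^{\delta}\cosh\varepsilon\end{pmatrix},$$ and let $\sigma_{(\varepsilon,\delta)}(\Theta)$ be the image of $\Theta$ (points and lines) under the projective transformation whose matrix in a $\Theta$-basis is $\Sigma_{(\varepsilon,\delta)}$. *)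

theory Defs
  imports "HOL-Analysis.Analysis"
begin

text \<open>We take V = real^3 (any 3-dimensional real vector space is isomorphic to it).
  A point of P(V) is a 1-dimensional linear subspace of V, a line of P(V) is a
  2-dimensional linear subspace.\<close>

definition is_ppoint :: "(real^3) set \<Rightarrow> bool" where
  "is_ppoint x \<longleftrightarrow> subspace x \<and> dim x = 1"

definition is_pline :: "(real^3) set \<Rightarrow> bool" where
  "is_pline L \<longleftrightarrow> subspace L \<and> dim L = 2"

text \<open>The line xy through two points.\<close>
definition pjoin :: "(real^3) set \<Rightarrow> (real^3) set \<Rightarrow> (real^3) set" where
  "pjoin x y = span (x \<union> y)"

text \<open>Homogeneous coordinates [a:b:c] relative to a basis given by the columns of A.\<close>
definition hpoint :: "real^3^3 \<Rightarrow> real \<Rightarrow> real \<Rightarrow> real \<Rightarrow> (real^3) set" where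
  "hpoint A a b c = span {A *v (\<chi> i. if i = 1 then a else if i = 2 then b else c)}"

text \<open>Boxes: OBox p q r s t b P Q R S T B.\<close>
datatype obox = OBox "(real^3) set" "(real^3) set" "(real^3) set" "(real^3) set"
  "(real^3) set" "(real^3) set" "(real^3) set" "(real^3) set" "(real^3) set"
  "(real^3) set" "(real^3) set" "(real^3) set"

fun overmarked :: "obox \<Rightarrow> bool" where
  "overmarked (OBox p q r s t b P Q R S T B) \<longleftrightarrow>
     is_ppoint p \<and> is_ppoint q \<and> is_ppoint r \<and> is_ppoint s \<and> is_ppoint t \<and> is_ppoint b \<and>
     is_pline P \<and> is_pline Q \<and> is_pline R \<and> is_pline S \<and> is_pline T \<and> is_pline B \<and>
     P = pjoin t s \<and> Q = pjoin t r \<and> R = pjoin b q \<and> S = pjoin b p \<and>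
     T = pjoin p q \<and> B = pjoin r s \<and>
     T \<noteq> B \<and> T \<inter> B \<notin> {p, q, r, s, t, b}"

text \<open>The involution j.\<close>
fun jbox :: "obox \<Rightarrow> obox" where
  "jbox (OBox p q r s t b P Q R S T B) = OBox q p s r t b Q P S R T B"

text \<open>A Theta-basis, encoded as the invertible matrix whose columns are the basis vectors.\<close>
fun theta_basis :: "obox \<Rightarrow> real^3^3 \<Rightarrow> bool" where
  "theta_basis (OBox p q r s t b P Q R S T B) A \<longleftrightarrow>
     invertible A \<and> p = hpoint A (-1) 1 0 \<and> q = hpoint A 1 1 0 \<and>
     r = hpoint A 1 0 1 \<and> s = hpoint A (-1) 0 1"

text \<open>Image of a box (points and lines) under a map of V.\<close>
fun obox_image :: "(real^3 \<Rightarrow> real^3) \<Rightarrow> obox \<Rightarrow> obox" where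
  "obox_image f (OBox p q r s t b P Q R S T B) =
     OBox (f ` p) (f ` q) (f ` r) (f ` s) (f ` t) (f ` b)
          (f ` P) (f ` Q) (f ` R) (f ` S) (f ` T) (f ` B)"

definition Sigma_mat :: "real \<Rightarrow> real \<Rightarrow> real^3^3" where
  "Sigma_mat \<epsilon> \<delta> = (\<chi> i j.
     if i = 1 then (if j = 1 then 1 else 0)
     else if i = 2 then (if j = 1 then 0 else if j = 2 then exp (-\<delta>) * cosh \<epsilon> else - sinh \<epsilon>)
     else (if j = 1 then 0 else if j = 2 then - sinh \<epsilon> else exp \<delta> * cosh \<epsilon>))"

text \<open>sigma: the projective transformation with matrix Sigma in a Theta-basis.\<close>
definition sigma :: "real \<Rightarrow> real \<Rightarrow> obox \<Rightarrow> obox" where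
  "sigma \<epsilon> \<delta> \<Theta> = (let A = (SOME A. theta_basis \<Theta> A) in
     obox_image (\<lambda>v. A *v (Sigma_mat \<epsilon> \<delta> *v (matrix_inv A *v v))) \<Theta>)"

end

theory Submission
  imports Defs
begin

text \<open>
  Four points p, q, r, s with T = pq, B = rs and T \<inter> B \<notin> {p, q, r, s} are in general position,
  so a \<Theta>-basis exists, and it is unique up to a scalar; hence \<sigma> is conjugation of \<Sigma> by any
  \<Theta>-basis A. The involution j exchanges p, q and r, s, which in coordinates is the reflection
  J = diag(-1, 1, 1): so AJ is a (j\<Theta>)-basis. As J commutes with \<Sigma>, conjugating \<Sigma> by A and by AJ
  gives the same linear automorphism of V, and \<sigma>(j\<Theta>) and \<sigma>(\<Theta>) are images of j\<Theta> and \<Theta> under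
  the same map, which commutes with j and preserves being overmarked.
\<close>

lemma
  fixes A :: "'a::semiring_1^'n^'n"
  assumes "invertible A"
  shows matrix_inv_right: "A ** matrix_inv A = mat 1"
    and matrix_inv_left: "matrix_inv A ** A = mat 1"
  using someI_ex[OF assms[unfolded invertible_def]] unfolding matrix_inv_def by auto

lemma invertible_matrix_inv:
  fixes A :: "'a::semiring_1^'n^'n"
  assumes "invertible A"
  shows "invertible (matrix_inv A)"
  unfolding invertible_def using matrix_inv_left[OF assms] matrix_inv_right[OF assms] by blast

lemma conjugate_eq_if_commute:
  fixes A C M :: "'a::comm_ring_1^'n^'n"
  assumes A: "invertible A" and AC: "invertible (A ** C)" and CM: "C ** M = M ** C"
  shows "(A ** C) ** M ** matrix_inv (A ** C) = A ** M ** matrix_inv A"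
proof -
  have "A ** M ** matrix_inv A ** (A ** C) = A ** M ** (matrix_inv A ** A) ** C"
    by (simp add: matrix_mul_assoc)
  also have "\<dots> = A ** (C ** M)"
    by (simp add: matrix_inv_left[OF A] CM matrix_mul_assoc)
  also have "\<dots> = (A ** C) ** M"
    by (simp add: matrix_mul_assoc)
  finally show ?thesis
    by (metis matrix_mul_assoc matrix_inv_right[OF AC] matrix_mul_rid)
qed

lemma span_Un_span: "span (span A \<union> span B) = span (A \<union> B)"
  unfolding span_eq by (auto intro: span_mono[THEN subsetD] span_base)

lemma scaleR_in_spanD: "c \<noteq> 0 \<Longrightarrow> c *\<^sub>R x \<in> span S \<Longrightarrow> x \<in> span S"
  using span_scale[of "c *\<^sub>R x" S "inverse c"] by simp

lemma span_singleton_scaleR: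
  fixes x :: "'a::real_vector"
  assumes "c \<noteq> 0"
  shows "span {c *\<^sub>R x} = span {x}"
  unfolding span_eq using scaleR_in_spanD[OF assms, of x "{c *\<^sub>R x}"]
  by (auto intro: span_scale span_base)

lemma span_singleton_eq_imp_scaled:
  fixes x y :: "'a::real_vector"
  assumes "span {y} = span {x}"
  shows "\<exists>k. y = k *\<^sub>R x"
proof -
  have "y \<in> span {x}"
    using assms span_base by blast
  then show ?thesis
    by (auto simp: span_singleton)
qed

lemma lincomb_in_span_pair: "a *\<^sub>R x + b *\<^sub>R y \<in> span {x, y}"
  by (intro span_add span_scale span_base) auto

lemma dim_span_pair_eq_2D:
  fixes u v :: "'a::euclidean_space"
  assumes "dim (span {u, v}) = 2"
  shows "u \<noteq> 0" "v \<notin> span {u}"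
  using assms dim_insert[of v "{u}"] by (auto simp: insert_commute split: if_splits)

lemma lincomb_3_eq_0_imp_coeffs_0:
  fixes u1 u2 u3 :: "'a::real_vector"
  assumes "u1 \<noteq> 0" "u2 \<notin> span {u1}" "u3 \<notin> span {u1, u2}"
    and eq: "a *\<^sub>R u1 + b *\<^sub>R u2 + c *\<^sub>R u3 = 0"
  shows "a = 0 \<and> b = 0 \<and> c = 0"
proof -
  have "c = 0"
  proof (rule ccontr)
    assume "c \<noteq> 0"
    have "c *\<^sub>R u3 = (a *\<^sub>R u1 + b *\<^sub>R u2 + c *\<^sub>R u3) - a *\<^sub>R u1 - b *\<^sub>R u2"
      by simp
    then have "c *\<^sub>R u3 = (-a) *\<^sub>R u1 + (-b) *\<^sub>R u2"
      unfolding eq by simp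
    with \<open>c \<noteq> 0\<close> show False
      using assms(3) scaleR_in_spanD lincomb_in_span_pair by metis
  qed
  moreover have "b = 0"
  proof (rule ccontr)
    assume "b \<noteq> 0"
    moreover have "b *\<^sub>R u2 = (-a) *\<^sub>R u1"
      using eq \<open>c = 0\<close> by (simp add: eq_neg_iff_add_eq_0 add.commute)
    ultimately show False
      using assms(2) scaleR_in_spanD span_base span_scale by (metis singletonI)
  qed
  ultimately show ?thesis
    using eq assms(1) by simp
qed

lemma lincomb_3_coeffs_nonzero:
  fixes u1 u2 u3 u4 :: "'a::real_vector"
  assumes u4: "u4 = a *\<^sub>R u1 + b *\<^sub>R u2 + c *\<^sub>R u3"
    and "u4 \<notin> span {u1, u2}" "u4 \<notin> span {u3}" "u1 \<notin> span {u3, u4}" "u2 \<notin> span {u3, u4}"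
  shows "a \<noteq> 0 \<and> b \<noteq> 0 \<and> c \<noteq> 0"
proof -
  have u1: "a *\<^sub>R u1 = 1 *\<^sub>R u4 + (-b) *\<^sub>R u2 + (-c) *\<^sub>R u3"
    and u2: "b *\<^sub>R u2 = 1 *\<^sub>R u4 + (-a) *\<^sub>R u1 + (-c) *\<^sub>R u3"
    using u4 by (simp_all add: algebra_simps)
  have "c \<noteq> 0"
    using u4 assms(2) lincomb_in_span_pair by fastforce
  moreover have "a \<noteq> 0"
  proof
    assume a: "a = 0"
    show False
    proof (cases "b = 0")
      case True
      then show False
        using u4 a assms(3) span_base span_scale by (metis add_0 scaleR_zero_left singletonI)
    next
      case False
      have "b *\<^sub>R u2 \<in> span {u3, u4}"
        using u2 a lincomb_in_span_pair[of 1 u4 "-c" u3] by (simp add: insert_commute)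
      then show False
        using False assms(5) scaleR_in_spanD by blast
    qed
  qed
  moreover have "b \<noteq> 0"
  proof
    assume "b = 0"
    then have "a *\<^sub>R u1 \<in> span {u3, u4}"
      using u1 lincomb_in_span_pair[of 1 u4 "-c" u3] by (simp add: insert_commute)
    then show False
      using \<open>a \<noteq> 0\<close> assms(4) scaleR_in_spanD by blast
  qed
  ultimately show ?thesis
    by blast
qed

lemma vector_3_eq_iff:
  "(vector [a, b, c] :: 'a::zero^3) = vector [a', b', c'] \<longleftrightarrow> a = a' \<and> b = b' \<and> c = c'"
  by (metis vector_3)

lemma scaleR_vector_3: "k *\<^sub>R (vector [a, b, c] :: real^3) = vector [k * a, k * b, k * c]"
  by (simp add: vec_eq_iff forall_3)

lemma matrix_vector_mult_vector_3:
  "(M :: real^3^3) *v vector [a, b, c] =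
     vector [M$1$1 * a + M$1$2 * b + M$1$3 * c, M$2$1 * a + M$2$2 * b + M$2$3 * c,
             M$3$1 * a + M$3$2 * b + M$3$3 * c]"
  by (simp add: vec_eq_iff forall_3 matrix_vector_mult_def sum_3)

lemma columns_mult:
  "transpose (vector [u1, u2, u3] :: real^3^3) *v x = x$1 *\<^sub>R u1 + x$2 *\<^sub>R u2 + x$3 *\<^sub>R u3"
  by (simp add: vec_eq_iff matrix_vector_mult_def sum_3 transpose_def mult.commute)

lemma invertible_columns:
  assumes "\<And>a b c. a *\<^sub>R u1 + b *\<^sub>R u2 + c *\<^sub>R u3 = 0 \<Longrightarrow> a = 0 \<and> b = 0 \<and> c = 0"
  shows "invertible (transpose (vector [u1, u2, u3]) :: real^3^3)"
proof -
  have "x = 0" if "transpose (vector [u1, u2, u3]) *v x = (0 :: real^3)" for x :: "real^3"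
    using assms[of "x$1" "x$2" "x$3"] that unfolding columns_mult by (simp add: vec_eq_iff forall_3)
  then have "inj ((*v) (transpose (vector [u1, u2, u3]) :: real^3^3))"
    unfolding vec.inj_iff_eq_0 by blast
  then show ?thesis
    using matrix_left_invertible_injective invertible_left_inverse by blast
qed

lemma ppoint_eq_span_singleton:
  assumes "is_ppoint x"
  obtains u where "x = span {u}"
proof -
  have x: "subspace x" "dim x = 1"
    using assms unfolding is_ppoint_def by auto
  obtain V where V: "V \<subseteq> x" "independent V" "x \<subseteq> span V" "card V = dim x"
    using basis_exists by blast
  then obtain u where u: "V = {u}"
    using x(2) card_1_singletonE by metis
  have "x = span {u}"
    using V(1,3) u x(1) span_minimal by blast
  then show ?thesis
    using that by blast
qed

lemma pline_Int_eq_ppoint: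
  assumes L: "is_pline L" and L': "is_pline L'" and "L \<noteq> L'"
    and x: "is_ppoint x" "x \<subseteq> L" "x \<subseteq> L'"
  shows "L \<inter> L' = x"
proof -
  have L_sub: "subspace L" "dim L = 2" and L'_sub: "subspace L'" "dim L' = 2"
    using L L' unfolding is_pline_def by auto
  have Int_sub: "subspace (L \<inter> L')"
    using L_sub L'_sub by (simp add: subspace_inter)
  have "dim (L \<inter> L') \<le> 1"
  proof (rule ccontr)
    assume "\<not> dim (L \<inter> L') \<le> 1"
    then have "dim (L \<inter> L') \<ge> 2"
      by simp
    then have "L \<inter> L' = L" "L \<inter> L' = L'"
      using L_sub L'_sub Int_sub by (intro subspace_dim_equal; simp)+
    then show False
      using \<open>L \<noteq> L'\<close> by simp
  qed
  then show ?thesis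
    using x Int_sub unfolding is_ppoint_def by (intro subspace_dim_equal[symmetric]) auto
qed

lemma generator_notin_pline:
  assumes "is_pline L" "is_pline L'" "L \<noteq> L'" "is_ppoint x" "x \<subseteq> L" "L \<inter> L' \<noteq> x"
    and x: "x = span {u}"
  shows "u \<notin> L'"
proof
  assume "u \<in> L'"
  then have "x \<subseteq> L'"
    using assms(2) x by (simp add: is_pline_def span_minimal)
  then show False
    using pline_Int_eq_ppoint assms by blast
qed

lemma pjoin_image: "linear f \<Longrightarrow> f ` pjoin x y = pjoin (f ` x) (f ` y)"
  unfolding pjoin_def by (simp add: linear_span_image[symmetric] image_Un)

lemma is_ppoint_image: "linear f \<Longrightarrow> inj f \<Longrightarrow> is_ppoint x \<Longrightarrow> is_ppoint (f ` x)"
  unfolding is_ppoint_def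
  by (metis dim_image_eq inj_on_subset subset_UNIV linear_subspace_image)

lemma is_pline_image: "linear f \<Longrightarrow> inj f \<Longrightarrow> is_pline x \<Longrightarrow> is_pline (f ` x)"
  unfolding is_pline_def
  by (metis dim_image_eq inj_on_subset subset_UNIV linear_subspace_image)

lemma overmarked_obox_image:
  assumes f: "linear f" "inj f" and ov: "overmarked \<Theta>"
  shows "overmarked (obox_image f \<Theta>)"
proof (cases \<Theta>)
  case (OBox p q r s t b P Q R S T B)
  have "f ` X = f ` Y \<longleftrightarrow> X = Y" "f ` X \<inter> f ` Y = f ` (X \<inter> Y)" for X Y
    using f(2) by (simp_all add: inj_image_eq_iff image_Int)
  with ov show ?thesis
    unfolding OBox overmarked.simps obox_image.simps
    by (elim conjE) (simp add: pjoin_image[OF f(1), symmetric] is_ppoint_image[OF f] is_pline_image[OF f])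
qed

lemma obox_image_jbox: "obox_image f (jbox \<Theta>) = jbox (obox_image f \<Theta>)"
  by (cases \<Theta>) simp

lemma hpoint_eq: "hpoint A a b c = span {A *v vector [a, b, c]}"
proof -
  have "(\<chi> i. if i = 1 then a else if i = 2 then b else c) = (vector [a, b, c] :: real^3)"
    by (simp add: vec_eq_iff forall_3)
  then show ?thesis
    by (simp add: hpoint_def)
qed

lemma theta_basis_invertible: "theta_basis \<Theta> A \<Longrightarrow> invertible A"
  by (cases \<Theta>) simp

lemma scalar_matrix_if_fixes_frame:
  fixes M :: "real^3^3"
  assumes "\<exists>k. M *v vector [-1, 1, 0] = k *\<^sub>R vector [-1, 1, 0]"
    and "\<exists>k. M *v vector [1, 1, 0] = k *\<^sub>R vector [1, 1, 0]"
    and "\<exists>k. M *v vector [1, 0, 1] = k *\<^sub>R vector [1, 0, 1]"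
    and "\<exists>k. M *v vector [-1, 0, 1] = k *\<^sub>R vector [-1, 0, 1]"
  shows "\<exists>k. M = k *\<^sub>R mat 1"
proof -
  from assms obtain k1 k2 k3 k4 where
    "M *v vector [-1, 1, 0] = k1 *\<^sub>R vector [-1, 1, 0]"
    "M *v vector [1, 1, 0] = k2 *\<^sub>R vector [1, 1, 0]"
    "M *v vector [1, 0, 1] = k3 *\<^sub>R vector [1, 0, 1]"
    "M *v vector [-1, 0, 1] = k4 *\<^sub>R vector [-1, 0, 1]"
    by blast
  then have "- M$1$1 + M$1$2 = -k1" "- M$2$1 + M$2$2 = k1" "- M$3$1 + M$3$2 = 0"
    "M$1$1 + M$1$2 = k2" "M$2$1 + M$2$2 = k2" "M$3$1 + M$3$2 = 0"
    "M$1$1 + M$1$3 = k3" "M$2$1 + M$2$3 = 0" "M$3$1 + M$3$3 = k3"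
    "- M$1$1 + M$1$3 = -k4" "- M$2$1 + M$2$3 = 0" "- M$3$1 + M$3$3 = k4"
    by (simp_all only: matrix_vector_mult_vector_3 scaleR_vector_3 vector_3_eq_iff, simp_all)
  then have "M = k1 *\<^sub>R mat 1"
    by (simp add: vec_eq_iff forall_3 mat_def)
  then show ?thesis ..
qed

lemma theta_basis_unique:
  assumes A: "theta_basis \<Theta> A" and A': "theta_basis \<Theta> A'"
  shows "\<exists>k. A' = k *\<^sub>R A"
proof -
  have A_inv: "invertible A"
    using theta_basis_invertible[OF A] .
  have fixes_point: "\<exists>k. (matrix_inv A ** A') *v v = k *\<^sub>R v"
    if eq: "span {A' *v v} = span {A *v v}" for v
  proof -
    obtain k where "A' *v v = k *\<^sub>R (A *v v)"
      using span_singleton_eq_imp_scaled[OF eq] by blast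
    then have "matrix_inv A *v (A' *v v) = k *\<^sub>R ((matrix_inv A ** A) *v v)"
      by (simp add: matrix_vector_mult_scaleR matrix_vector_mul_assoc)
    then show ?thesis
      by (simp add: matrix_inv_left[OF A_inv] matrix_vector_mul_assoc)
  qed
  obtain k where k: "matrix_inv A ** A' = k *\<^sub>R mat 1"
    using scalar_matrix_if_fixes_frame[OF fixes_point fixes_point fixes_point fixes_point]
      A A' by (cases \<Theta>) (auto simp: hpoint_eq)
  have "A' = A ** (matrix_inv A ** A')"
    by (simp add: matrix_mul_assoc matrix_inv_right[OF A_inv])
  also have "\<dots> = k *\<^sub>R A"
    by (simp add: k matrix_scalar_ac)
  finally show ?thesis ..
qed

lemma overmarked_frame_vectors:
  assumes "overmarked (OBox p q r s t b P Q R S T B)"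
  obtains u1 u2 u3 u4 where "p = span {u1}" "q = span {u2}" "r = span {u3}" "s = span {u4}"
    and "u1 \<noteq> 0" "u2 \<notin> span {u1}" "u3 \<notin> span {u1, u2}"
    and "u4 \<notin> span {u1, u2}" "u4 \<notin> span {u3}" "u1 \<notin> span {u3, u4}" "u2 \<notin> span {u3, u4}"
proof -
  have pts: "is_ppoint p" "is_ppoint q" "is_ppoint r" "is_ppoint s"
    and lines: "is_pline T" "is_pline B" "T \<noteq> B"
    and joins: "T = pjoin p q" "B = pjoin r s"
    and meet: "T \<inter> B \<noteq> p" "T \<inter> B \<noteq> q" "B \<inter> T \<noteq> r" "B \<inter> T \<noteq> s"
    using assms unfolding overmarked.simps Int_commute[of B T] by blast+
  obtain u1 u2 u3 u4 where u: "p = span {u1}" "q = span {u2}" "r = span {u3}" "s = span {u4}"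
    by (metis ppoint_eq_span_singleton pts)
  have T: "T = span {u1, u2}" and B: "B = span {u3, u4}"
    unfolding joins u pjoin_def span_Un_span by (simp_all add: insert_commute)
  have "dim (span {u1, u2}) = 2" "dim (span {u3, u4}) = 2"
    using lines unfolding T B is_pline_def by simp_all
  note not_collinear = dim_span_pair_eq_2D[OF this(1)] dim_span_pair_eq_2D[OF this(2)]
  have in_T: "p \<subseteq> T" "q \<subseteq> T" and in_B: "r \<subseteq> B" "s \<subseteq> B"
    unfolding T B u by (simp_all add: span_mono)
  have notin: "u1 \<notin> B" "u2 \<notin> B" "u3 \<notin> T" "u4 \<notin> T"
    using generator_notin_pline[OF lines(1,2,3) pts(1) in_T(1) meet(1) u(1)]
      generator_notin_pline[OF lines(1,2,3) pts(2) in_T(2) meet(2) u(2)]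
      generator_notin_pline[OF lines(2,1) lines(3)[symmetric] pts(3) in_B(1) meet(3) u(3)]
      generator_notin_pline[OF lines(2,1) lines(3)[symmetric] pts(4) in_B(2) meet(4) u(4)] .
  show ?thesis
    using notin(3,4,1,2) unfolding T B by (rule that[OF u not_collinear(1,2) _ _ not_collinear(4)])
qed

lemma projective_frame_exists:
  fixes U :: "real^3^3"
  assumes U: "invertible U" and abc: "a \<noteq> 0" "b \<noteq> 0" "c \<noteq> 0"
  obtains A where "invertible A"
    "hpoint A (-1) 1 0 = span {U *v vector [1, 0, 0]}"
    "hpoint A 1 1 0 = span {U *v vector [0, 1, 0]}"
    "hpoint A 1 0 1 = span {U *v vector [0, 0, 1]}"
    "hpoint A (-1) 0 1 = span {U *v vector [a, b, c]}"
proof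
  define N :: "real^3^3" where
    "N = (\<chi> i j. if i = 1 then (if j = 1 then -a/2 else a/2)
        else if i = 2 then (if j = 3 then b/2 else -b/2) else (if j = 3 then c else 0))"
  have det_N: "det N = a * b * c / 2"
    by (simp add: det_3 N_def field_simps)
  have "invertible N"
    using abc by (simp add: invertible_det_nz det_N)
  then show "invertible (U ** N)"
    using U by (simp add: invertible_mult)
  have frame_point: "hpoint (U ** N) x y z = span {U *v e}"
    if "N *v vector [x, y, z] = k *\<^sub>R e" "k \<noteq> 0" for x y z k e
    using that by (simp add: hpoint_eq matrix_vector_mul_assoc[symmetric]
        matrix_vector_mult_scaleR span_singleton_scaleR)
  have N: "N *v vector [-1, 1, 0] = a *\<^sub>R vector [1, 0, 0]"
    "N *v vector [1, 1, 0] = (-b) *\<^sub>R vector [0, 1, 0]"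
    "N *v vector [1, 0, 1] = c *\<^sub>R vector [0, 0, 1]"
    "N *v vector [-1, 0, 1] = 1 *\<^sub>R vector [a, b, c]"
    by (simp_all add: matrix_vector_mult_vector_3 scaleR_vector_3 N_def)
  show "hpoint (U ** N) (-1) 1 0 = span {U *v vector [1, 0, 0]}"
    using frame_point[OF N(1)] abc by simp
  show "hpoint (U ** N) 1 1 0 = span {U *v vector [0, 1, 0]}"
    using frame_point[OF N(2)] abc by simp
  show "hpoint (U ** N) 1 0 1 = span {U *v vector [0, 0, 1]}"
    using frame_point[OF N(3)] abc by simp
  show "hpoint (U ** N) (-1) 0 1 = span {U *v vector [a, b, c]}"
    using frame_point[OF N(4)] by simp
qed

lemma theta_basis_exists:
  assumes "overmarked \<Theta>"
  obtains A where "theta_basis \<Theta> A"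
proof (cases \<Theta>)
  case (OBox p q r s t b P Q R S T B)
  obtain u1 u2 u3 u4 where u: "p = span {u1}" "q = span {u2}" "r = span {u3}" "s = span {u4}"
    and indep: "u1 \<noteq> 0" "u2 \<notin> span {u1}" "u3 \<notin> span {u1, u2}"
    and general: "u4 \<notin> span {u1, u2}" "u4 \<notin> span {u3}" "u1 \<notin> span {u3, u4}" "u2 \<notin> span {u3, u4}"
    by (rule overmarked_frame_vectors[OF assms[unfolded OBox]])
  define U :: "real^3^3" where "U = transpose (vector [u1, u2, u3])"
  have U: "invertible U"
    unfolding U_def using lincomb_3_eq_0_imp_coeffs_0[OF indep] by (rule invertible_columns)
  define w where "w = matrix_inv U *v u4"
  have Uw: "U *v vector [w$1, w$2, w$3] = u4"
  proof -
    have "vector [w$1, w$2, w$3] = w"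
      by (simp add: vec_eq_iff forall_3)
    then show ?thesis
      unfolding w_def by (simp add: matrix_vector_mul_assoc matrix_inv_right[OF U])
  qed
  then have "u4 = w$1 *\<^sub>R u1 + w$2 *\<^sub>R u2 + w$3 *\<^sub>R u3"
    unfolding U_def columns_mult by simp
  then have w: "w$1 \<noteq> 0" "w$2 \<noteq> 0" "w$3 \<noteq> 0"
    using lincomb_3_coeffs_nonzero general by blast+
  obtain A where "invertible A"
    "hpoint A (-1) 1 0 = span {U *v vector [1, 0, 0]}"
    "hpoint A 1 1 0 = span {U *v vector [0, 1, 0]}"
    "hpoint A 1 0 1 = span {U *v vector [0, 0, 1]}"
    "hpoint A (-1) 0 1 = span {U *v vector [w$1, w$2, w$3]}"
    using projective_frame_exists[OF U w] .
  then have "theta_basis \<Theta> A"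
    unfolding Uw unfolding OBox u U_def columns_mult by simp
  then show ?thesis
    using that by blast
qed

definition J_mat :: "real^3^3" where
  "J_mat = (\<chi> i j. if i = j then (if i = 1 then -1 else 1) else 0)"

lemma J_mat_vector_3: "J_mat *v vector [a, b, c] = vector [-a, b, c]"
  by (simp add: matrix_vector_mult_vector_3 J_mat_def)

lemma invertible_J_mat: "invertible J_mat"
proof -
  have "J_mat ** J_mat = mat 1"
    by (simp add: vec_eq_iff forall_3 matrix_matrix_mult_def sum_3 J_mat_def mat_def)
  then show ?thesis
    unfolding invertible_def by blast
qed

lemma J_mat_Sigma_mat_commute: "J_mat ** Sigma_mat \<epsilon> \<delta> = Sigma_mat \<epsilon> \<delta> ** J_mat"
  by (simp add: vec_eq_iff forall_3 matrix_matrix_mult_def sum_3 J_mat_def Sigma_mat_def)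

lemma theta_basis_jbox: "theta_basis \<Theta> A \<Longrightarrow> theta_basis (jbox \<Theta>) (A ** J_mat)"
  by (cases \<Theta>) (auto simp: hpoint_eq matrix_vector_mul_assoc[symmetric] J_mat_vector_3
      invertible_mult invertible_J_mat)

lemma invertible_Sigma_mat: "invertible (Sigma_mat \<epsilon> \<delta>)"
proof -
  have "det (Sigma_mat \<epsilon> \<delta>) = (exp (-\<delta>) * exp \<delta>) * (cosh \<epsilon>)\<^sup>2 - (sinh \<epsilon>)\<^sup>2"
    by (simp add: det_3 Sigma_mat_def power2_eq_square)
  also have "\<dots> = 1"
    by (simp add: exp_minus cosh_square_eq)
  finally show ?thesis
    by (simp add: invertible_det_nz)
qed

lemma sigma_eq_conjugate:
  assumes A: "theta_basis \<Theta> A"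
  shows "sigma \<epsilon> \<delta> \<Theta> = obox_image ((*v) (A ** Sigma_mat \<epsilon> \<delta> ** matrix_inv A)) \<Theta>"
proof -
  define A0 where "A0 = (SOME A. theta_basis \<Theta> A)"
  have A0: "theta_basis \<Theta> A0"
    unfolding A0_def using A by (rule someI)
  then obtain k where k: "A0 = A ** (k *\<^sub>R mat 1)"
    using theta_basis_unique[OF A] by (auto simp: matrix_scalar_ac)
  have "(k *\<^sub>R mat 1) ** Sigma_mat \<epsilon> \<delta> = Sigma_mat \<epsilon> \<delta> ** (k *\<^sub>R (mat 1 :: real^3^3))"
    by (simp add: matrix_scalar_ac scalar_matrix_assoc[symmetric])
  with A A0 have "A0 ** Sigma_mat \<epsilon> \<delta> ** matrix_inv A0 = A ** Sigma_mat \<epsilon> \<delta> ** matrix_inv A"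
    unfolding k by (intro conjugate_eq_if_commute theta_basis_invertible)
  then show ?thesis
    unfolding sigma_def Let_def A0_def[symmetric]
    by (simp add: fun_eq_iff matrix_vector_mul_assoc matrix_mul_assoc)
qed

theorem lemma7p1:
  fixes \<epsilon> \<delta> :: real and \<Theta> :: obox
  assumes "overmarked \<Theta>"
  shows "overmarked (sigma \<epsilon> \<delta> \<Theta>) \<and> sigma \<epsilon> \<delta> (jbox \<Theta>) = jbox (sigma \<epsilon> \<delta> \<Theta>)"
proof -
  obtain A where A: "theta_basis \<Theta> A"
    using theta_basis_exists[OF assms] .
  have A_inv: "invertible A"
    using theta_basis_invertible[OF A] .
  define M where "M = A ** Sigma_mat \<epsilon> \<delta> ** matrix_inv A"
  have sigma_\<Theta>: "sigma \<epsilon> \<delta> \<Theta> = obox_image ((*v) M) \<Theta>"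
    unfolding M_def by (rule sigma_eq_conjugate[OF A])
  have "(A ** J_mat) ** Sigma_mat \<epsilon> \<delta> ** matrix_inv (A ** J_mat) = M"
    unfolding M_def using A_inv theta_basis_invertible[OF theta_basis_jbox[OF A]]
    by (rule conjugate_eq_if_commute[OF _ _ J_mat_Sigma_mat_commute])
  then have sigma_j\<Theta>: "sigma \<epsilon> \<delta> (jbox \<Theta>) = obox_image ((*v) M) (jbox \<Theta>)"
    using sigma_eq_conjugate[OF theta_basis_jbox[OF A]] by simp
  have "invertible M"
    unfolding M_def by (intro invertible_mult A_inv invertible_Sigma_mat invertible_matrix_inv)
  then have "overmarked (obox_image ((*v) M) \<Theta>)"
    using overmarked_obox_image[OF matrix_vector_mul_linear inj_matrix_vector_mult] assms by blast
  then show ?thesis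
    unfolding sigma_\<Theta> sigma_j\<Theta> obox_image_jbox by simp
qed

end
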